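(* Let $G=(V,E,\sigma,T)$ be a temporal graph, let $s,t\in V$ be distinct vertices, let $\Gamma=\Gamma^{\mathrm{trp}}(s,t)$ be the family of time-respecting paths from $s$ to $t$, and let $\check\Gamma$ be its projection to the aggregated (static) graph. For $\lambda>0$ let $\mathrm{Mod}^\lambda_{p,\sigma}(\Gamma)$ be the temporal $p$-modulus of $\Gamma$ with temporal penalty function $\varphi^\lambda(\tau)=\varphi(\lambda\tau)$. Let $p\in[1,\infty]$. Then the function $\lambda\mapsto\mathrm{Mod}^\lambda_{p,\sigma}(\Gamma)$ is monotonically nonincreasing on $(0,\infty)$ and $$\lim_{\lambda\to0^+}\mathrm{Mod}^\lambda_{p,\sigma}(\Gamma)=\mathrm{Mod}_{p,\sigma}(\check\Gamma).$$ Moreover, suppose $p\in(1,\infty)$, let $\rho^\lambda$ be the unique optimal density for $\mathrm{Mod}^\lambda_{p,\sigma}(\Gamma)$, and let $\check\rho$ be the unique optimal density for $\mathrm{Mod}_{p,\sigma}(\check\Gamma)$. Then $$\lim_{\lambda\to0^+}\rho^\lambda=\check\rho.$$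
   Context: A temporal graph $G=(V,E,\sigma,T)$ consists of a finite graph with vertex set $V$ and edge set $E$ (directed or undirected, parallel edges allowed), edge weights $\sigma:E\to(0,\infty)$, and a map $T$ assigning to each edge $e$ a finite nonempty set $T(e)\subset(0,\infty)$ of times at which $e$ is available. The aggregated graph is $\check G=(V,E,\sigma)$. A time-respecting path from $s$ to $t$ is a set of edge-time pairs $\gamma=\{(e_1,t_1),\dots,(e_k,t_k)\}$, with the edges $e_i$ pairwise distinct, such that $e_1e_2\cdots e_k$, traversed in order, is a path from $s$ to $t$, $t_i\in T(e_i)$ for all $i$, and $t_1<t_2<\cdots<t_k$. $\Gamma=\Gamma^{\mathrm{trp}}(s,t)$ is the (finite) set of all such paths. The projection of $\gamma$ is $\check\gamma=\{e_1,\dots,e_k\}\subseteq E$, and $\check\Gamma=\{\check\gamma:\gamma\in\Gamma\}$. The temporal penalty function $\varphi:\mathbb{R}\to[0,\infty)$ is a fixed continuous, strictly increasing function with $\varphi(0)=1$. A density is a vector $\rho\in\mathbb{R}^E_{\ge0}$. Its energy is $\mathcal{E}_{p,\sigma}(\rho)=\sum_{e\in E}\sigma(e)\rho(e)^p$ for $1\le p<\infty$ and $\mathcal{E}_{\infty,\sigma}(\rho)=\max_{e\in E}\sigma(e)\rho(e)$. For $\gamma=\{(e_1,t_1),\dots,(e_k,t_k)\}\in\Gamma$ and $\lambda>0$ define the $\lambda$-parametrized temporal length $\ell^\lambda_\rho(\gamma)=\sum_{i=1}^k\rho(e_i)\varphi(\lambda t_i)$, and for $\check\gamma\in\check\Gamma$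 define the static length $\ell_\rho(\check\gamma)=\sum_{e\in\check\gamma}\rho(e)$. Then $\mathrm{Mod}^\lambda_{p,\sigma}(\Gamma)$ is the minimum of $\mathcal{E}_{p,\sigma}(\rho)$ over $\rho\in\mathbb{R}^E_{\ge0}$ with $\ell^\lambda_\rho(\gamma)\ge1$ for all $\gamma\in\Gamma$, and $\mathrm{Mod}_{p,\sigma}(\check\Gamma)$ is the minimum of $\mathcal{E}_{p,\sigma}(\rho)$ over $\rho\in\mathbb{R}^E_{\ge0}$ with $\ell_\rho(\check\gamma)\ge1$ for all $\check\gamma\in\check\Gamma$. Minimizers are called optimal densities; they are unique for $p\in(1,\infty)$. *)

theory Defs
  imports "HOL-Analysis.Analysis"
begin

text \<open>
  Temporal multigraphs. An edge \<open>e\<close> with \<open>ends G e = (u, v)\<close> runs from \<open>u\<close> to \<open>v\<close> if \<open>G\<close> is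
  directed; if \<open>G\<close> is undirected, the order of the two ends carries no meaning. Edges are
  abstract elements, so parallel edges (and loops) are permitted.
\<close>

record ('v, 'e) temporal_graph =
  verts :: "'v set"
  edges :: "'e set"
  ends :: "'e \<Rightarrow> 'v \<times> 'v"
  directed :: bool
  weight :: "'e \<Rightarrow> real"
  times :: "'e \<Rightarrow> real set"

definition wf_temporal_graph :: "('v, 'e) temporal_graph \<Rightarrow> bool" where
  "wf_temporal_graph G \<longleftrightarrow>
     finite (verts G) \<and> finite (edges G) \<and>
     (\<forall>e\<in>edges G. ends G e \<in> verts G \<times> verts G) \<and>
     (\<forall>e\<in>edges G. 0 < weight G e) \<and>
     (\<forall>e\<in>edges G. finite (times G e) \<and> times G e \<noteq> {} \<and> times G e \<subseteq> {0<..})"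

definition traverses :: "('v, 'e) temporal_graph \<Rightarrow> 'e \<Rightarrow> 'v \<Rightarrow> 'v \<Rightarrow> bool" where
  "traverses G e u v \<longleftrightarrow> ends G e = (u, v) \<or> (\<not> directed G \<and> ends G e = (v, u))"

text \<open>
  The list \<open>vs\<close> below is the sequence of vertices visited. A path visits no vertex twice.
\<close>

definition is_path :: "('v, 'e) temporal_graph \<Rightarrow> 'v \<Rightarrow> 'e list \<Rightarrow> 'v \<Rightarrow> bool" where
  "is_path G s es t \<longleftrightarrow> set es \<subseteq> edges G \<and>
     (\<exists>vs. set vs \<subseteq> verts G \<and> length vs = Suc (length es) \<and> hd vs = s \<and> last vs = t \<and>
        distinct vs \<and> (\<forall>i<length es. traverses G (es ! i) (vs ! i) (vs ! Suc i)))"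

definition trp :: "('v, 'e) temporal_graph \<Rightarrow> 'v \<Rightarrow> 'v \<Rightarrow> ('e \<times> real) set set" where
  "trp G s t = {set (zip es ts) | es ts.
     length es = length ts \<and> distinct es \<and> is_path G s es t \<and>
     (\<forall>i<length es. ts ! i \<in> times G (es ! i)) \<and> sorted_wrt (<) ts}"

definition projection :: "('e \<times> real) set set \<Rightarrow> 'e set set" where
  "projection \<Gamma> = (\<lambda>\<gamma>. fst ` \<gamma>) ` \<Gamma>"

text \<open>
  The cone of nonnegative vectors indexed by \<open>edges G\<close>. A vector is an extensional function, so
  that it is determined by its values on the edges, and the (product) topology of the function
  type induces the usual topology of the finite-dimensional space.
\<close>

definition densities :: "('v, 'e) temporal_graph \<Rightarrow> ('e \<Rightarrow> real) set" where
  "densities G = (edges G \<rightarrow>\<^sub>E {0..})"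

text \<open>The maximum over an empty edge set is read as 0.\<close>

definition energy :: "('v, 'e) temporal_graph \<Rightarrow> ereal \<Rightarrow> ('e \<Rightarrow> real) \<Rightarrow> real" where
  "energy G p \<rho> =
     (if p = \<infinity>
      then (if edges G = {} then 0 else Max ((\<lambda>e. weight G e * \<rho> e) ` edges G))
      else (\<Sum>e\<in>edges G. weight G e * \<rho> e powr real_of_ereal p))"

definition temporal_length ::
  "(real \<Rightarrow> real) \<Rightarrow> real \<Rightarrow> ('e \<Rightarrow> real) \<Rightarrow> ('e \<times> real) set \<Rightarrow> real" where
  "temporal_length \<phi> l \<rho> \<gamma> = (\<Sum>(e, \<tau>)\<in>\<gamma>. \<rho> e * \<phi> (l * \<tau>))"

definition static_length :: "('e \<Rightarrow> real) \<Rightarrow> 'e set \<Rightarrow> real" where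
  "static_length \<rho> c = (\<Sum>e\<in>c. \<rho> e)"

definition temporal_admissible ::
  "('v, 'e) temporal_graph \<Rightarrow> (real \<Rightarrow> real) \<Rightarrow> real \<Rightarrow> ('e \<times> real) set set \<Rightarrow> ('e \<Rightarrow> real) set"
  where
  "temporal_admissible G \<phi> l \<Gamma> = {\<rho>\<in>densities G. \<forall>\<gamma>\<in>\<Gamma>. 1 \<le> temporal_length \<phi> l \<rho> \<gamma>}"

definition static_admissible ::
  "('v, 'e) temporal_graph \<Rightarrow> 'e set set \<Rightarrow> ('e \<Rightarrow> real) set" where
  "static_admissible G C = {\<rho>\<in>densities G. \<forall>c\<in>C. 1 \<le> static_length \<rho> c}"

text \<open>
  The moduli are minima (not merely infima): the least element of the set of energies of
  admissible densities.
\<close>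

definition temporal_Mod ::
  "('v, 'e) temporal_graph \<Rightarrow> (real \<Rightarrow> real) \<Rightarrow> ereal \<Rightarrow> real \<Rightarrow> ('e \<times> real) set set \<Rightarrow> real" where
  "temporal_Mod G \<phi> p l \<Gamma> = (LEAST m. m \<in> energy G p ` temporal_admissible G \<phi> l \<Gamma>)"

definition static_Mod :: "('v, 'e) temporal_graph \<Rightarrow> ereal \<Rightarrow> 'e set set \<Rightarrow> real" where
  "static_Mod G p C = (LEAST m. m \<in> energy G p ` static_admissible G C)"

definition temporal_optimal ::
  "('v, 'e) temporal_graph \<Rightarrow> (real \<Rightarrow> real) \<Rightarrow> ereal \<Rightarrow> real \<Rightarrow> ('e \<times> real) set set
     \<Rightarrow> ('e \<Rightarrow> real) \<Rightarrow> bool" where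
  "temporal_optimal G \<phi> p l \<Gamma> \<rho> \<longleftrightarrow>
     is_arg_min (energy G p) (\<lambda>\<rho>. \<rho> \<in> temporal_admissible G \<phi> l \<Gamma>) \<rho>"

definition static_optimal ::
  "('v, 'e) temporal_graph \<Rightarrow> ereal \<Rightarrow> 'e set set \<Rightarrow> ('e \<Rightarrow> real) \<Rightarrow> bool" where
  "static_optimal G p C \<rho> \<longleftrightarrow>
     is_arg_min (energy G p) (\<lambda>\<rho>. \<rho> \<in> static_admissible G C) \<rho>"

end

theory Submission
  imports Defs
begin

text \<open>
  Since \<open>\<phi> 0 = 1\<close>, the static problem is the temporal problem at \<open>\<lambda> = 0\<close>. For \<open>\<lambda> \<ge> 0\<close> the admissible
  sets grow with \<open>\<lambda>\<close>, so the modulus decreases. If \<open>b\<close> bounds all the times, then an admissible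
  density for \<open>\<lambda>\<close> becomes admissible for \<open>0\<close> after multiplication by \<open>\<phi> (\<lambda> b)\<close>, which tends to 1.
  By homogeneity of the energy, this squeezes the modulus. The rescaled optimal densities form a
  minimizing sequence for the static problem, hence converge to its minimizer, which is unique by
  strict convexity, because the sublevel sets of the energy are compact.
\<close>

section \<open>Strict convexity of powers\<close>

text \<open>A power with exponent above 1 is strictly convex, so it lies above its tangent at 1.
  With \<open>x = exp z\<close> this reduces to \<open>1 + y < exp y\<close> for nonzero
  \<open>y\<close>, used at \<open>(r - 1) * z\<close> and at \<open>- z\<close>.\<close>

lemma powr_tangent_at_1:
  fixes x r :: real
  assumes "0 \<le> x" "1 < r"
  shows "1 + r * (x - 1) \<le> x powr r"
    and "x \<noteq> 1 \<Longrightarrow> 1 + r * (x - 1) < x powr r"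
proof -
  show strict: "1 + r * (x - 1) < x powr r" if "x \<noteq> 1"
  proof (cases "x = 0")
    case True
    with assms show ?thesis by simp
  next
    case False
    with assms have x: "0 < x" by simp
    define z where "z = ln x"
    have xz: "x = exp z" using x by (simp add: z_def)
    have z: "z \<noteq> 0" using that xz by auto
    have exp_strict: "1 + y < exp y" if "y \<noteq> 0" for y :: real
      using that ln_eq_minus_one[of "exp y"] exp_ge_add_one_self[of y]
      by (metis add_diff_cancel_left' exp_gt_zero exp_eq_one_iff ln_exp order_le_imp_less_or_eq)
    have "1 + (r - 1) * z < exp ((r - 1) * z)"
      using exp_strict z assms by simp
    \<comment> \<open>The weight \<open>r - 1\<close> makes the terms linear in \<open>z\<close>
      cancel in the sum of the two inequalities, which leaves the constant \<open>r\<close> on the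
      left.\<close>
    moreover have "(r - 1) * (1 + - z) < (r - 1) * exp (- z)"
      using exp_strict[of "- z"] z assms by (intro mult_strict_left_mono) auto
    ultimately have "r < exp ((r - 1) * z) + (r - 1) * exp (- z)"
      by (simp add: algebra_simps)
    then have "exp z * r < exp z * (exp ((r - 1) * z) + (r - 1) * exp (- z))"
      by simp
    also have "\<dots> = exp (r * z) + (r - 1)"
      by (simp add: algebra_simps flip: exp_add)
    finally have "r * x < exp (r * z) + r - 1" by (simp add: xz algebra_simps)
    moreover have "x powr r = exp (r * z)" using x by (simp add: powr_def z_def)
    ultimately show ?thesis by (simp add: algebra_simps)
  qed
  show "1 + r * (x - 1) \<le> x powr r"
    using strict by (cases "x = 1") auto
qed

text \<open>Dividing by the midpoint \<open>m\<close> turns \<open>x\<close> and \<open>y\<close>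
  into two numbers with sum 2. Adding their tangent inequalities at 1 cancels the linear
  terms.\<close>

lemma powr_midpoint:
  fixes x y r :: real
  assumes "0 \<le> x" "0 \<le> y" "1 < r"
  shows "((x + y) / 2) powr r \<le> (x powr r + y powr r) / 2"
    and "x \<noteq> y \<Longrightarrow> ((x + y) / 2) powr r < (x powr r + y powr r) / 2"
proof -
  show strict: "((x + y) / 2) powr r < (x powr r + y powr r) / 2" if "x \<noteq> y"
  proof -
    define m where "m = (x + y) / 2"
    have m: "0 < m" using assms that by (simp add: m_def)
    then have xm: "x / m \<noteq> 1" using that by (simp add: m_def)
    have "x + y = 2 * m" by (simp add: m_def)
    then have s: "x / m + y / m = 2" using m by (simp flip: add_divide_distrib)
    have "1 + r * (x / m - 1) < (x / m) powr r"
      using powr_tangent_at_1(2)[of "x / m" r] assms m xm by simp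
    moreover have "1 + r * (y / m - 1) \<le> (y / m) powr r"
      using powr_tangent_at_1(1)[of "y / m" r] assms m by simp
    moreover have "(1 + r * (x / m - 1)) + (1 + r * (y / m - 1)) = 2 + r * (x / m + y / m - 2)"
      by (simp only: algebra_simps)
    ultimately have "2 < (x / m) powr r + (y / m) powr r" using s by simp
    also have "\<dots> = (x powr r + y powr r) / m powr r"
      using assms m by (simp add: powr_divide add_divide_distrib)
    finally show ?thesis using m by (simp add: field_simps flip: m_def)
  qed
  show "((x + y) / 2) powr r \<le> (x powr r + y powr r) / 2"
    using strict by (cases "x = y") auto
qed

section \<open>The energy\<close>

lemma continuous_on_Max:
  fixes f :: "'i \<Rightarrow> 'a::topological_space \<Rightarrow> real"
  assumes "finite I" "I \<noteq> {}" "\<And>i. i \<in> I \<Longrightarrow> continuous_on S (f i)"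
  shows "continuous_on S (\<lambda>x. Max ((\<lambda>i. f i x) ` I))"
  using assms
  by (induction I rule: finite_ne_induct) (auto intro!: continuous_intros)

lemma densities_nonneg: "\<rho> \<in> densities G \<Longrightarrow> e \<in> edges G \<Longrightarrow> 0 \<le> \<rho> e"
  by (auto simp: densities_def)

lemma continuous_on_energy:
  assumes "wf_temporal_graph G" "1 \<le> p"
  shows "continuous_on (densities G) (energy G p)"
proof (cases "p = \<infinity>")
  case True
  show ?thesis
  proof (cases "edges G = {}")
    case False
    have "continuous_on (densities G) (\<lambda>\<rho>. Max ((\<lambda>e. weight G e * \<rho> e) ` edges G))"
      using assms False
      by (intro continuous_on_Max continuous_intros
          continuous_on_subset[OF continuous_on_product_coordinates])
        (auto simp: wf_temporal_graph_def)
    then show ?thesis using True False by (simp add: energy_def[abs_def])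
  qed (use True in \<open>simp add: energy_def[abs_def]\<close>)
next
  case False
  with assms have p: "0 < real_of_ereal p"
    by (cases p) (auto simp flip: one_ereal_def)
  have "continuous_on (densities G) (\<lambda>\<rho>. \<Sum>e\<in>edges G. weight G e * \<rho> e powr real_of_ereal p)"
    using p
    \<comment> \<open>The base may reach 0; continuity there rests on a nonnegative base and a
      positive exponent.\<close>
    by (intro continuous_intros continuous_on_powr'
        continuous_on_subset[OF continuous_on_product_coordinates])
      (auto simp: densities_nonneg)
  then show ?thesis using False by (simp add: energy_def[abs_def])
qed

text \<open>Bounds each coordinate by the energy, which puts sublevel sets inside a box. The extra
  term \<open>weight G e\<close> allows one bound for all \<open>p\<close>: for finite
  \<open>p\<close> a coordinate is at most 1 or at most its own power.\<close>

lemma energy_coercive: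
  assumes "wf_temporal_graph G" "1 \<le> p" "\<rho> \<in> densities G" "e \<in> edges G"
  shows "weight G e * \<rho> e \<le> weight G e + energy G p \<rho>"
proof -
  have fin: "finite (edges G)" and w: "\<And>e. e \<in> edges G \<Longrightarrow> 0 < weight G e"
    using assms by (auto simp: wf_temporal_graph_def)
  show ?thesis
  proof (cases "p = \<infinity>")
    case True
    then have "weight G e * \<rho> e \<le> energy G p \<rho>"
      using fin assms(4) by (auto simp: energy_def)
    then show ?thesis using w[OF assms(4)] by simp
  next
    case False
    with assms(2) have p: "1 \<le> real_of_ereal p"
      by (cases p) auto
    have "\<rho> e \<le> 1 + \<rho> e powr real_of_ereal p"
    proof (cases "\<rho> e \<le> 1")
      case True
      then show ?thesis using powr_ge_zero[of "\<rho> e" "real_of_ereal p"] by linarith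
    next
      case False
      then show ?thesis using powr_mono[OF p, of "\<rho> e"] by simp
    qed
    then have "weight G e * \<rho> e \<le> weight G e * (1 + \<rho> e powr real_of_ereal p)"
      using w[OF assms(4)] by simp
    also have "\<dots> = weight G e + weight G e * \<rho> e powr real_of_ereal p"
      by (simp add: algebra_simps)
    also have "weight G e * \<rho> e powr real_of_ereal p \<le> energy G p \<rho>"
      using False fin assms(4) w
      by (auto simp: energy_def less_imp_le intro!: member_le_sum)
    finally show ?thesis by simp
  qed
qed

text \<open>The energy is positively homogeneous, of degree \<open>p\<close> for finite
  \<open>p\<close> and of degree 1 for \<open>p = \<infinity>\<close>; this is the factor gained
  when a density is multiplied by \<open>c\<close>.\<close>

definition energy_factor :: "ereal \<Rightarrow> real \<Rightarrow> real" where
  "energy_factor p c = (if p = \<infinity> then c else c powr real_of_ereal p)"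

lemma energy_factor_pos: "0 < c \<Longrightarrow> 0 < energy_factor p c"
  by (simp add: energy_factor_def)

lemma tendsto_energy_factor_1:
  assumes "(f \<longlongrightarrow> 1) F"
  shows "((\<lambda>x. energy_factor p (f x)) \<longlongrightarrow> 1) F"
  using assms tendsto_powr[OF assms tendsto_const, of "real_of_ereal p"]
  by (cases "p = \<infinity>") (simp_all add: energy_factor_def[abs_def])

lemma energy_scale:
  assumes "wf_temporal_graph G" "\<rho> \<in> densities G" "0 \<le> c"
  shows "energy G p (\<lambda>e\<in>edges G. c * \<rho> e) = energy_factor p c * energy G p \<rho>"
proof (cases "p = \<infinity>")
  case True
  show ?thesis
  proof (cases "edges G = {}")
    case False
    \<comment> \<open>Multiplication by a nonnegative \<open>c\<close> is monotone and therefore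
      commutes with the maximum.\<close>
    have "Max ((\<lambda>x. c * x) ` (\<lambda>e. weight G e * \<rho> e) ` edges G)
        = c * Max ((\<lambda>e. weight G e * \<rho> e) ` edges G)"
      using assms False
      by (intro mono_Max_commute[symmetric])
        (auto simp: wf_temporal_graph_def mono_def mult_left_mono)
    moreover have "(\<lambda>x. c * x) ` (\<lambda>e. weight G e * \<rho> e) ` edges G
        = (\<lambda>e. weight G e * (\<lambda>e\<in>edges G. c * \<rho> e) e) ` edges G"
      by (auto simp: image_image mult_ac intro!: image_cong)
    ultimately show ?thesis
      using True False by (simp add: energy_def energy_factor_def)
  qed (simp add: energy_def True)
next
  case False
  then show ?thesis
    using assms
    by (auto simp: energy_def energy_factor_def sum_distrib_left powr_mult densities_nonneg
        intro!: sum.cong)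
qed

text \<open>Strict convexity of the energy: the midpoint inequality for powers holds on every edge
  and is strict on an edge where the densities differ; the weights are positive.\<close>

lemma energy_midpoint_less:
  assumes "wf_temporal_graph G" "1 < p" "p < \<infinity>"
    and "\<rho> \<in> densities G" "\<rho>' \<in> densities G" "\<rho> \<noteq> \<rho>'"
  shows "energy G p (\<lambda>e\<in>edges G. (\<rho> e + \<rho>' e) / 2) < (energy G p \<rho> + energy G p \<rho>') / 2"
proof -
  have fin: "finite (edges G)" and w: "\<And>e. e \<in> edges G \<Longrightarrow> 0 < weight G e"
    using assms by (auto simp: wf_temporal_graph_def)
  define r where "r = real_of_ereal p"
  have r: "1 < r" and p: "p \<noteq> \<infinity>"
    using assms(2,3) by (cases p; auto simp: r_def)+
  \<comment> \<open>Densities are extensional and agree off the edges, so two distinct ones differ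
    on some edge.\<close>
  obtain a where a: "a \<in> edges G" "\<rho> a \<noteq> \<rho>' a"
    using assms(4-6) unfolding densities_def by (metis PiE_ext)
  note nn = assms(4,5)[THEN densities_nonneg]
  have "(\<Sum>e\<in>edges G. weight G e * ((\<rho> e + \<rho>' e) / 2) powr r)
      < (\<Sum>e\<in>edges G. weight G e * ((\<rho> e powr r + \<rho>' e powr r) / 2))"
  proof (rule sum_strict_mono_ex1[OF fin])
    show "\<forall>e\<in>edges G. weight G e * ((\<rho> e + \<rho>' e) / 2) powr r
        \<le> weight G e * ((\<rho> e powr r + \<rho>' e powr r) / 2)"
      using w nn r powr_midpoint(1) by (intro ballI mult_left_mono) (auto simp: less_imp_le)
    show "\<exists>e\<in>edges G. weight G e * ((\<rho> e + \<rho>' e) / 2) powr r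
        < weight G e * ((\<rho> e powr r + \<rho>' e powr r) / 2)"
      using a w nn r powr_midpoint(2) by (intro bexI[of _ a] mult_strict_left_mono) auto
  qed
  also have "\<dots> = (energy G p \<rho> + energy G p \<rho>') / 2"
    using p by (simp add: energy_def r_def sum_divide_distrib distrib_left add_divide_distrib
        flip: sum.distrib)
  finally show ?thesis
    using p by (simp add: energy_def r_def)
qed

section \<open>Compactness of sublevel sets\<close>

text \<open>Tychonoff's theorem, carried over to the topology of the function type.\<close>

lemma compact_PiE_UNIV:
  fixes S :: "'i \<Rightarrow> 'a::topological_space set"
  assumes "\<And>i. compact (S i)"
  shows "compact (PiE UNIV S)"
proof -
  have "compactin (product_topology (\<lambda>i. euclidean) UNIV) (PiE UNIV S)"
    using assms by (simp add: compactin_PiE)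
  then show ?thesis by (simp add: euclidean_product_topology)
qed

lemma tendsto_coordinatewise:
  fixes f :: "'b \<Rightarrow> 'i \<Rightarrow> 'a::topological_space"
  assumes "\<And>i. ((\<lambda>x. f x i) \<longlongrightarrow> l i) F"
  shows "(f \<longlongrightarrow> l) F"
proof -
  have "limitin (product_topology (\<lambda>i. euclidean) UNIV) f l F"
    using assms by (simp add: limitin_componentwise)
  then show ?thesis by (simp add: euclidean_product_topology)
qed

lemma closed_densities: "closed (densities G)"
proof -
  have "densities G = {\<rho>. \<forall>e. (e \<in> edges G \<longrightarrow> 0 \<le> \<rho> e) \<and> (e \<notin> edges G \<longrightarrow> \<rho> e = undefined)}"
    by (auto simp: densities_def PiE_iff extensional_def)
  also have "closed \<dots>"
    by (intro closed_Collect_all closed_Collect_conj closed_Collect_imp open_Collect_const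
        closed_Collect_le closed_Collect_eq continuous_on_const continuous_on_product_coordinates)
  finally show ?thesis .
qed

lemma compact_energy_sublevel:
  assumes "wf_temporal_graph G" "1 \<le> p"
  shows "compact {\<rho>\<in>densities G. energy G p \<rho> \<le> M}"
proof -
  \<comment> \<open>The upper end is the coercivity bound solved for the coordinate. Off the edges
    the only value is \<open>undefined\<close>, so every factor of the product is compact.\<close>
  define S where "S = (\<lambda>e. if e \<in> edges G then {0..(weight G e + M) / weight G e} else {undefined})"
  have "compact (PiE UNIV S)"
    by (rule compact_PiE_UNIV) (simp add: S_def)
  moreover have "closed (densities G \<inter> energy G p -` {..M})"
    using assms by (intro continuous_closed_preimage continuous_on_energy closed_densities) auto
  ultimately have "compact (PiE UNIV S \<inter> (densities G \<inter> energy G p -` {..M}))"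
    by (rule compact_Int_closed)
  moreover have "densities G \<inter> energy G p -` {..M} \<subseteq> PiE UNIV S"
  proof (rule subsetI)
    fix \<rho> assume \<rho>: "\<rho> \<in> densities G \<inter> energy G p -` {..M}"
    have "\<rho> e \<in> S e" for e
    proof (cases "e \<in> edges G")
      case True
      then have "0 < weight G e" using assms(1) by (simp add: wf_temporal_graph_def)
      moreover have "weight G e * \<rho> e \<le> weight G e + M"
        using energy_coercive[OF assms, of \<rho> e] \<rho> True by simp
      ultimately show ?thesis
        using True \<rho> densities_nonneg[of \<rho> G e] by (simp add: S_def field_simps)
    next
      case False
      then show ?thesis using \<rho> by (auto simp: S_def densities_def)
    qed
    then show "\<rho> \<in> PiE UNIV S" by (simp add: PiE_iff)
  qed
  ultimately show ?thesis
    by (simp add: Int_absorb1 vimage_def Collect_conj_eq)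
qed

text \<open>Cutting \<open>A\<close> down to the sublevel set of one of its members leaves a
  nonempty compact set, and whatever was cut away has larger energy than that member.\<close>

lemma energy_attains_min:
  assumes "wf_temporal_graph G" "1 \<le> p" "closed A" "A \<subseteq> densities G" "A \<noteq> {}"
  obtains \<rho> where "is_arg_min (energy G p) (\<lambda>\<rho>. \<rho> \<in> A) \<rho>"
proof -
  obtain \<rho>0 where \<rho>0: "\<rho>0 \<in> A" using assms by blast
  define K where "K = {\<rho>\<in>densities G. energy G p \<rho> \<le> energy G p \<rho>0} \<inter> A"
  have "compact K"
    unfolding K_def using assms by (intro compact_Int_closed compact_energy_sublevel)
  moreover have "K \<noteq> {}" using \<rho>0 assms by (auto simp: K_def)
  moreover have "continuous_on K (energy G p)"
    using continuous_on_energy[OF assms(1,2)] by (rule continuous_on_subset) (auto simp: K_def)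
  ultimately obtain \<rho> where "\<rho> \<in> K" "\<forall>\<rho>'\<in>K. energy G p \<rho> \<le> energy G p \<rho>'"
    using continuous_attains_inf by blast
  with \<rho>0 assms have "is_arg_min (energy G p) (\<lambda>\<rho>. \<rho> \<in> A) \<rho>"
    by (fastforce simp: is_arg_min_linorder K_def)
  then show thesis by (rule that)
qed

text \<open>Identifies the \<open>LEAST\<close> in the definition of a modulus with the energy of an
  optimal density.\<close>

lemma Least_image_is_arg_min:
  fixes f :: "'a \<Rightarrow> 'b::linorder"
  assumes "is_arg_min f (\<lambda>x. x \<in> A) x"
  shows "(LEAST m. m \<in> f ` A) = f x"
  using assms by (intro Least_equality) (auto simp: is_arg_min_linorder)

text \<open>
  The compactness argument: away from the minimizer, but within a sublevel set, the energy is
  bounded away from its minimum.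
\<close>

lemma minimizing_tendsto:
  assumes "wf_temporal_graph G" "1 \<le> p" "closed A" "A \<subseteq> densities G"
    and "is_arg_min (energy G p) (\<lambda>\<rho>. \<rho> \<in> A) \<rho>'"
    and "\<And>\<rho>. is_arg_min (energy G p) (\<lambda>\<rho>. \<rho> \<in> A) \<rho> \<Longrightarrow> \<rho> = \<rho>'"
    and "\<forall>\<^sub>F x in F. f x \<in> A"
    and "((\<lambda>x. energy G p (f x)) \<longlongrightarrow> energy G p \<rho>') F"
  shows "(f \<longlongrightarrow> \<rho>') F"
proof (intro tendsto_coordinatewise tendstoI)
  fix e and \<epsilon> :: real assume "0 < \<epsilon>"
  \<comment> \<open>The members of \<open>A\<close> that are far from the minimizer in coordinate
    \<open>e\<close>. This set is closed, so unless it is empty the energy attains a minimum on it,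
    which by uniqueness exceeds the minimum on \<open>A\<close>. Once the energy of
    \<open>f x\<close> is below that value, \<open>f x\<close> lies outside
    \<open>B\<close>.\<close>
  define B where "B = A \<inter> {\<rho>. \<epsilon> \<le> dist (\<rho> e) (\<rho>' e)}"
  have "closed B"
    unfolding B_def using assms(3)
    by (intro closed_Int closed_Collect_le continuous_intros continuous_on_product_coordinates)
  show "\<forall>\<^sub>F x in F. dist (f x e) (\<rho>' e) < \<epsilon>"
  proof (cases "B = {}")
    case True
    then have "dist (\<rho> e) (\<rho>' e) < \<epsilon>" if "\<rho> \<in> A" for \<rho>
      using that by (auto simp: B_def not_le)
    with assms(7) show ?thesis by (auto elim: eventually_mono)
  next
    case False
    then obtain \<rho> where \<rho>: "is_arg_min (energy G p) (\<lambda>\<rho>. \<rho> \<in> B) \<rho>"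
      using energy_attains_min[OF assms(1,2) \<open>closed B\<close>] assms(4) by (auto simp: B_def)
    then have "\<rho> \<in> A" "\<rho> \<noteq> \<rho>'"
      using \<open>0 < \<epsilon>\<close> by (auto simp: is_arg_min_def B_def)
    then have "energy G p \<rho>' < energy G p \<rho>"
      using assms(5) assms(6)[of \<rho>] by (force simp: is_arg_min_linorder)
    with assms(8) have "\<forall>\<^sub>F x in F. energy G p (f x) < energy G p \<rho>"
      by (rule order_tendstoD)
    with assms(7) show ?thesis
    proof eventually_elim
      case (elim x)
      then have "f x \<notin> B" using \<rho> by (auto simp: is_arg_min_linorder)
      with elim show ?case by (auto simp: B_def)
    qed
  qed
qed

section \<open>Families of time-respecting edge sets\<close>

text \<open>The argument treats a time-respecting path as a finite nonempty set of edge-time pairs,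
  without repeated edges. The parameter 0 is then allowed on the same footing as positive
  ones.\<close>

locale temporal_family =
  fixes G :: "('v, 'e) temporal_graph"
    and \<phi> :: "real \<Rightarrow> real"
    and \<Gamma> :: "('e \<times> real) set set"
  assumes wf: "wf_temporal_graph G"
    and cont: "continuous_on UNIV \<phi>"
    and mono: "mono \<phi>"
    and phi_0: "\<phi> 0 = 1"
    and finite_member: "\<gamma> \<in> \<Gamma> \<Longrightarrow> finite \<gamma>"
    and nonempty_member: "\<gamma> \<in> \<Gamma> \<Longrightarrow> \<gamma> \<noteq> {}"
    and inj_member: "\<gamma> \<in> \<Gamma> \<Longrightarrow> inj_on fst \<gamma>"
    and member_subset: "\<gamma> \<in> \<Gamma> \<Longrightarrow> \<gamma> \<subseteq> Sigma (edges G) (times G)"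
begin

section \<open>Admissible sets of the temporal problems\<close>

abbreviation "adm l \<equiv> temporal_admissible G \<phi> l \<Gamma>"

lemma time_pos: "e \<in> edges G \<Longrightarrow> \<tau> \<in> times G e \<Longrightarrow> 0 < \<tau>"
  using wf by (auto simp: wf_temporal_graph_def)

text \<open>At parameter 0 every penalty is \<open>\<phi> 0 = 1\<close>. Since \<open>fst\<close> is
  injective on a member of \<Gamma>, the sum over its projection is the sum over its edge-time
  pairs.\<close>

lemma static_admissible_eq: "static_admissible G (projection \<Gamma>) = adm 0"
  using inj_member
  by (auto simp: static_admissible_def temporal_admissible_def projection_def static_length_def
      temporal_length_def phi_0 sum.reindex case_prod_unfold)

lemma static_Mod_eq: "static_Mod G p (projection \<Gamma>) = temporal_Mod G \<phi> p 0 \<Gamma>"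
  by (simp add: static_Mod_def temporal_Mod_def static_admissible_eq)

lemma static_optimal_eq: "static_optimal G p (projection \<Gamma>) = temporal_optimal G \<phi> p 0 \<Gamma>"
  by (simp add: fun_eq_iff static_optimal_def temporal_optimal_def static_admissible_eq)

lemma adm_subset: "adm l \<subseteq> densities G"
  by (auto simp: temporal_admissible_def)

lemma closed_adm: "closed (adm l)"
proof -
  have "adm l = densities G \<inter> (\<Inter>\<gamma>\<in>\<Gamma>. {\<rho>. 1 \<le> temporal_length \<phi> l \<rho> \<gamma>})"
    by (auto simp: temporal_admissible_def)
  also have "closed \<dots>"
    unfolding temporal_length_def case_prod_unfold
    by (intro closed_Int closed_densities closed_INT ballI closed_Collect_le continuous_intros
        continuous_on_product_coordinates)
  finally show ?thesis .
qed

text \<open>Times are positive and densities nonnegative, so raising the parameter raises every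
  penalty and hence every length.\<close>

lemma adm_mono:
  assumes "0 \<le> l" "l \<le> l'"
  shows "adm l \<subseteq> adm l'"
proof
  fix \<rho> assume \<rho>: "\<rho> \<in> adm l"
  have "temporal_length \<phi> l \<rho> \<gamma> \<le> temporal_length \<phi> l' \<rho> \<gamma>" if "\<gamma> \<in> \<Gamma>" for \<gamma>
    unfolding temporal_length_def case_prod_unfold
  proof (intro sum_mono mult_left_mono monoD[OF mono] mult_right_mono)
    fix x assume "x \<in> \<gamma>"
    then have x: "fst x \<in> edges G" "snd x \<in> times G (fst x)"
      using member_subset[OF that] by auto
    show "0 \<le> snd x" using time_pos[OF x] by simp
    show "0 \<le> \<rho> (fst x)"
      using \<rho> adm_subset densities_nonneg[OF _ x(1)] by blast
  qed (rule assms)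
  with \<rho> show "\<rho> \<in> adm l'"
    by (force simp: temporal_admissible_def)
qed

text \<open>The density 1 on all edges gives \<gamma> the length \<open>card \<gamma>\<close> at
  parameter 0, which is at least 1 because \<gamma> is finite and nonempty; \<open>adm_mono\<close>
  carries this to \<open>l\<close>.\<close>

lemma adm_nonempty:
  assumes "0 \<le> l"
  shows "adm l \<noteq> {}"
proof -
  have "(\<lambda>e\<in>edges G. 1) \<in> adm 0"
  proof -
    have "1 \<le> temporal_length \<phi> 0 (\<lambda>e\<in>edges G. 1) \<gamma>" if "\<gamma> \<in> \<Gamma>" for \<gamma>
    proof -
      have "temporal_length \<phi> 0 (\<lambda>e\<in>edges G. 1) \<gamma> = (\<Sum>x\<in>\<gamma>. 1)"
        unfolding temporal_length_def
        using member_subset[OF that] by (intro sum.cong) (auto simp: phi_0)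
      moreover have "0 < card \<gamma>"
        using finite_member[OF that] nonempty_member[OF that] by (simp add: card_gt_0_iff)
      ultimately show ?thesis by simp
    qed
    then show ?thesis by (simp add: temporal_admissible_def densities_def)
  qed
  then show ?thesis using adm_mono[OF order_refl assms] by blast
qed

section \<open>Existence of optimal densities and monotonicity of the modulus\<close>

lemma optimal_exists:
  assumes "0 \<le> l" "1 \<le> p"
  obtains \<rho> where "temporal_optimal G \<phi> p l \<Gamma> \<rho>"
  using energy_attains_min[OF wf assms(2) closed_adm adm_subset adm_nonempty[OF assms(1)]]
  unfolding temporal_optimal_def by blast

lemma Mod_eq:
  assumes "temporal_optimal G \<phi> p l \<Gamma> \<rho>"
  shows "temporal_Mod G \<phi> p l \<Gamma> = energy G p \<rho>"
  using assms unfolding temporal_Mod_def temporal_optimal_def by (rule Least_image_is_arg_min)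

lemma optimal_mem: "temporal_optimal G \<phi> p l \<Gamma> \<rho> \<Longrightarrow> \<rho> \<in> adm l"
  by (simp add: temporal_optimal_def is_arg_min_def)

lemma Mod_le:
  assumes "0 \<le> l" "1 \<le> p" "\<rho> \<in> adm l"
  shows "temporal_Mod G \<phi> p l \<Gamma> \<le> energy G p \<rho>"
proof -
  obtain \<rho>' where opt: "temporal_optimal G \<phi> p l \<Gamma> \<rho>'"
    using optimal_exists[OF assms(1,2)] .
  with assms(3) have "energy G p \<rho>' \<le> energy G p \<rho>"
    by (simp add: temporal_optimal_def is_arg_min_linorder)
  with opt show ?thesis by (simp add: Mod_eq)
qed

lemma Mod_antimono:
  assumes "0 \<le> l" "l \<le> l'" "1 \<le> p"
  shows "temporal_Mod G \<phi> p l' \<Gamma> \<le> temporal_Mod G \<phi> p l \<Gamma>"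
proof -
  obtain \<rho> where opt: "temporal_optimal G \<phi> p l \<Gamma> \<rho>"
    using optimal_exists[OF assms(1,3)] .
  then have "\<rho> \<in> adm l'" using adm_mono[OF assms(1,2)] optimal_mem by blast
  then show ?thesis using Mod_le[of l' p \<rho>] opt assms by (simp add: Mod_eq)
qed

section \<open>Rescaling, and the limit of the modulus\<close>

lemma times_bounded:
  obtains b where "\<And>e \<tau>. e \<in> edges G \<Longrightarrow> \<tau> \<in> times G e \<Longrightarrow> \<tau> \<le> b"
proof -
  have "finite (\<Union>e\<in>edges G. times G e)"
    using wf by (auto simp: wf_temporal_graph_def)
  then have "bdd_above (\<Union>e\<in>edges G. times G e)" by (rule bdd_above_finite)
  then show thesis using that by (auto simp: bdd_above_def)
qed

text \<open>Replacing each penalty by its upper bound \<open>c\<close> cannot shorten a path. Moving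
  \<open>c\<close> into the density then leaves the penalty 1, which is the penalty at parameter
  0.\<close>

lemma scaled_adm_0:
  assumes "0 \<le> l" "\<rho> \<in> adm l"
    and "\<And>e \<tau>. e \<in> edges G \<Longrightarrow> \<tau> \<in> times G e \<Longrightarrow> \<phi> (l * \<tau>) \<le> c"
    and "0 \<le> c"
  shows "(\<lambda>e\<in>edges G. c * \<rho> e) \<in> adm 0"
proof -
  have nn: "\<And>e. e \<in> edges G \<Longrightarrow> 0 \<le> \<rho> e"
    using assms(2) adm_subset by (blast intro: densities_nonneg)
  have "1 \<le> temporal_length \<phi> 0 (\<lambda>e\<in>edges G. c * \<rho> e) \<gamma>" if "\<gamma> \<in> \<Gamma>" for \<gamma>
  proof -
    have "1 \<le> temporal_length \<phi> l \<rho> \<gamma>"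
      using assms(2) that by (simp add: temporal_admissible_def)
    also have "\<dots> \<le> (\<Sum>x\<in>\<gamma>. \<rho> (fst x) * c)"
      unfolding temporal_length_def case_prod_unfold
      using member_subset[OF that] nn assms(3) by (intro sum_mono mult_left_mono) auto
    also have "\<dots> = temporal_length \<phi> 0 (\<lambda>e\<in>edges G. c * \<rho> e) \<gamma>"
      unfolding temporal_length_def case_prod_unfold
      using member_subset[OF that] by (intro sum.cong) (auto simp: phi_0)
    finally show ?thesis .
  qed
  then show ?thesis
    using nn assms(4) by (auto simp: temporal_admissible_def densities_def)
qed

text \<open>Collects the three properties of the factor on which both limits rest, that of the
  moduli and that of the optimal densities.\<close>

lemma scaling_factor:
  "\<exists>c. (\<forall>l>0. 0 < c l) \<and> (c \<longlongrightarrow> 1) (at_right 0) \<and>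
    (\<forall>l>0. \<forall>\<rho>\<in>adm l. (\<lambda>e\<in>edges G. c l * \<rho> e) \<in> adm 0)"
proof -
  obtain b where b: "\<And>e \<tau>. e \<in> edges G \<Longrightarrow> \<tau> \<in> times G e \<Longrightarrow> \<tau> \<le> b"
    using times_bounded by blast
  \<comment> \<open>Without edges the bound \<open>b\<close> is arbitrary and may be negative. The
    maximum keeps the argument of \<phi> nonnegative for positive \<open>l\<close>, whence
    \<open>c l\<close> is at least \<open>\<phi> 0 = 1\<close>.\<close>
  define c where "c l = \<phi> (l * max 0 b)" for l
  have pos: "0 < c l" if "0 < l" for l
    using monoD[OF mono, of 0 "l * max 0 b"] that by (simp add: c_def phi_0)
  have "continuous_on UNIV c"
    unfolding c_def by (intro continuous_on_compose2[OF cont] continuous_intros) auto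
  then have "(c \<longlongrightarrow> c 0) (at_right 0)"
    by (metis UNIV_I continuous_on_def tendsto_within_subset top_greatest)
  then have "(c \<longlongrightarrow> 1) (at_right 0)" by (simp add: c_def phi_0)
  moreover have "(\<lambda>e\<in>edges G. c l * \<rho> e) \<in> adm 0" if "0 < l" "\<rho> \<in> adm l" for l \<rho>
  proof (rule scaled_adm_0[OF _ that(2)])
    show "\<phi> (l * \<tau>) \<le> c l" if "e \<in> edges G" "\<tau> \<in> times G e" for e \<tau>
      using b[OF that] \<open>0 < l\<close>
      unfolding c_def by (intro monoD[OF mono] mult_left_mono) auto
  qed (use that pos[of l] in auto)
  ultimately show ?thesis using pos by blast
qed

lemma Mod_tendsto:
  assumes "1 \<le> p"
  shows "((\<lambda>l. temporal_Mod G \<phi> p l \<Gamma>) \<longlongrightarrow> temporal_Mod G \<phi> p 0 \<Gamma>) (at_right 0)"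
proof -
  obtain c where c: "\<And>l. 0 < l \<Longrightarrow> 0 < c l" "(c \<longlongrightarrow> 1) (at_right 0)"
    "\<And>l \<rho>. 0 < l \<Longrightarrow> \<rho> \<in> adm l \<Longrightarrow> (\<lambda>e\<in>edges G. c l * \<rho> e) \<in> adm 0"
    using scaling_factor by metis
  have lower: "temporal_Mod G \<phi> p 0 \<Gamma> / energy_factor p (c l) \<le> temporal_Mod G \<phi> p l \<Gamma>"
    if "0 < l" for l
  proof -
    obtain \<rho> where opt: "temporal_optimal G \<phi> p l \<Gamma> \<rho>"
      using optimal_exists[OF less_imp_le[OF \<open>0 < l\<close>] assms] .
    have \<rho>: "\<rho> \<in> densities G" using optimal_mem[OF opt] adm_subset by blast
    have "temporal_Mod G \<phi> p 0 \<Gamma> \<le> energy G p (\<lambda>e\<in>edges G. c l * \<rho> e)"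
      using c(3)[OF that optimal_mem[OF opt]] assms by (intro Mod_le) auto
    also have "\<dots> = energy_factor p (c l) * temporal_Mod G \<phi> p l \<Gamma>"
      using energy_scale[OF wf \<rho>] c(1)[OF that] Mod_eq[OF opt] by simp
    finally show ?thesis
      using energy_factor_pos[OF c(1)[OF that]] by (simp add: field_simps)
  qed
  show ?thesis
  proof (rule tendsto_sandwich)
    show "\<forall>\<^sub>F l in at_right 0. temporal_Mod G \<phi> p 0 \<Gamma> / energy_factor p (c l)
        \<le> temporal_Mod G \<phi> p l \<Gamma>"
      using lower by (auto simp: eventually_at_filter)
    \<comment> \<open>Monotonicity holds down to the parameter 0 itself, which gives the upper
      bound.\<close>
    show "\<forall>\<^sub>F l in at_right 0. temporal_Mod G \<phi> p l \<Gamma> \<le> temporal_Mod G \<phi> p 0 \<Gamma>"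
      using Mod_antimono[of 0 _ p] assms by (auto simp: eventually_at_filter)
    show "((\<lambda>l. temporal_Mod G \<phi> p 0 \<Gamma> / energy_factor p (c l))
        \<longlongrightarrow> temporal_Mod G \<phi> p 0 \<Gamma>) (at_right 0)"
      using tendsto_divide[OF tendsto_const tendsto_energy_factor_1[OF c(2)]] by fastforce
  qed (rule tendsto_const)
qed

section \<open>Uniqueness and convergence of optimal densities\<close>

text \<open>Lengths are linear in the density, so the midpoint \<open>m\<close> of two optimal
  densities is admissible. If they differed, its energy would lie strictly below the average of
  theirs, contradicting optimality.\<close>

lemma optimal_unique:
  assumes "1 < p" "p < \<infinity>"
    and "temporal_optimal G \<phi> p l \<Gamma> \<rho>" "temporal_optimal G \<phi> p l \<Gamma> \<rho>'"
  shows "\<rho> = \<rho>'"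
proof (rule ccontr)
  assume ne: "\<rho> \<noteq> \<rho>'"
  define m where "m = (\<lambda>e\<in>edges G. (\<rho> e + \<rho>' e) / 2)"
  have mem: "\<rho> \<in> adm l" "\<rho>' \<in> adm l" using assms(3,4) optimal_mem by blast+
  have "1 \<le> temporal_length \<phi> l m \<gamma>" if "\<gamma> \<in> \<Gamma>" for \<gamma>
  proof -
    have "1 \<le> (temporal_length \<phi> l \<rho> \<gamma> + temporal_length \<phi> l \<rho>' \<gamma>) / 2"
      using mem that by (fastforce simp: temporal_admissible_def)
    also have "\<dots> = (\<Sum>x\<in>\<gamma>. (\<rho> (fst x) + \<rho>' (fst x)) / 2 * \<phi> (l * snd x))"
      by (simp add: temporal_length_def case_prod_unfold sum_divide_distrib add_divide_distrib
          distrib_right flip: sum.distrib)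
    also have "\<dots> = temporal_length \<phi> l m \<gamma>"
      unfolding temporal_length_def case_prod_unfold
      using member_subset[OF that] by (intro sum.cong) (auto simp: m_def)
    finally show ?thesis .
  qed
  moreover have "0 \<le> \<rho> e" "0 \<le> \<rho>' e" if "e \<in> edges G" for e
    using mem adm_subset that by (blast intro: densities_nonneg)+
  then have "m \<in> densities G" by (simp add: m_def densities_def)
  ultimately have "m \<in> adm l" by (simp add: temporal_admissible_def)
  then have "energy G p \<rho> \<le> energy G p m" "energy G p \<rho>' \<le> energy G p m"
    using assms(3,4) by (auto simp: temporal_optimal_def is_arg_min_linorder)
  moreover have "energy G p m < (energy G p \<rho> + energy G p \<rho>') / 2"
    unfolding m_def using wf assms(1,2) mem adm_subset ne by (intro energy_midpoint_less) auto
  ultimately show False by simp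
qed

lemma optimal_ex1:
  assumes "1 < p" "p < \<infinity>" "0 \<le> l"
  shows "\<exists>!\<rho>. temporal_optimal G \<phi> p l \<Gamma> \<rho>"
proof (rule ex_ex1I)
  show "\<exists>\<rho>. temporal_optimal G \<phi> p l \<Gamma> \<rho>"
    using optimal_exists[OF assms(3) less_imp_le[OF assms(1)]] by blast
qed (rule optimal_unique[OF assms(1,2)])

lemma optimal_tendsto:
  assumes "1 < p" "p < \<infinity>"
    and opt: "\<And>l. 0 < l \<Longrightarrow> temporal_optimal G \<phi> p l \<Gamma> (\<rho> l)"
    and opt0: "temporal_optimal G \<phi> p 0 \<Gamma> \<rho>'"
  shows "(\<rho> \<longlongrightarrow> \<rho>') (at_right 0)"
proof -
  have p: "1 \<le> p" using assms by simp
  obtain c where c: "\<And>l. 0 < l \<Longrightarrow> 0 < c l" "(c \<longlongrightarrow> 1) (at_right 0)"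
    "\<And>l \<rho>. 0 < l \<Longrightarrow> \<rho> \<in> adm l \<Longrightarrow> (\<lambda>e\<in>edges G. c l * \<rho> e) \<in> adm 0"
    using scaling_factor by metis
  \<comment> \<open>The optimal densities lie in sets that vary with \<open>l\<close>; after
    rescaling they all lie in \<open>adm 0\<close>, as the compactness argument requires.\<close>
  define f where "f l = (\<lambda>e\<in>edges G. c l * \<rho> l e)" for l
  have energy_f: "energy G p (f l) = energy_factor p (c l) * temporal_Mod G \<phi> p l \<Gamma>"
    if "0 < l" for l
  proof -
    have "\<rho> l \<in> densities G" using optimal_mem[OF opt[OF that]] adm_subset by blast
    then show ?thesis
      using energy_scale[OF wf] c(1)[OF that] Mod_eq[OF opt[OF that]] by (simp add: f_def)
  qed
  have "(f \<longlongrightarrow> \<rho>') (at_right 0)"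
  proof (rule minimizing_tendsto[OF wf p closed_adm adm_subset])
    show "is_arg_min (energy G p) (\<lambda>\<rho>. \<rho> \<in> adm 0) \<rho>'"
      using opt0 by (simp add: temporal_optimal_def)
    show "\<sigma> = \<rho>'" if "is_arg_min (energy G p) (\<lambda>\<rho>. \<rho> \<in> adm 0) \<sigma>" for \<sigma>
      using optimal_unique[OF assms(1,2) _ opt0] that by (simp add: temporal_optimal_def)
    show "\<forall>\<^sub>F l in at_right 0. f l \<in> adm 0"
      using c(3) optimal_mem[OF opt] by (auto simp: eventually_at_filter f_def)
    have "((\<lambda>l. energy_factor p (c l) * temporal_Mod G \<phi> p l \<Gamma>) \<longlongrightarrow> 1 * energy G p \<rho>')
        (at_right 0)"
      using Mod_tendsto[OF p] Mod_eq[OF opt0] tendsto_energy_factor_1[OF c(2)]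
      by (intro tendsto_mult) auto
    moreover have "\<forall>\<^sub>F l in at_right 0.
        energy_factor p (c l) * temporal_Mod G \<phi> p l \<Gamma> = energy G p (f l)"
      using energy_f by (auto simp: eventually_at_filter)
    ultimately show "((\<lambda>l. energy G p (f l)) \<longlongrightarrow> energy G p \<rho>') (at_right 0)"
      by (auto dest: Lim_transform_eventually)
  qed
  then have f_coord: "((\<lambda>l. f l e) \<longlongrightarrow> \<rho>' e) (at_right 0)" for e
    by (rule continuous_on_tendsto_compose[OF continuous_on_product_coordinates]) auto
  show ?thesis
  proof (rule tendsto_coordinatewise)
    fix e
    show "((\<lambda>l. \<rho> l e) \<longlongrightarrow> \<rho>' e) (at_right 0)"
    proof (cases "e \<in> edges G")
      case True
      \<comment> \<open>On an edge the rescaling is undone by dividing by \<open>c l\<close>, which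
        tends to 1.\<close>
      have "((\<lambda>l. f l e / c l) \<longlongrightarrow> \<rho>' e / 1) (at_right 0)"
        using f_coord c(2) by (intro tendsto_divide) auto
      moreover have "f l e / c l = \<rho> l e" if "0 < l" for l
        using c(1)[OF that] True by (simp add: f_def)
      then have "\<forall>\<^sub>F l in at_right 0. f l e / c l = \<rho> l e"
        by (auto simp: eventually_at_filter)
      ultimately show ?thesis by (auto dest: Lim_transform_eventually)
    next
      case False
      \<comment> \<open>Convergence in the function type concerns all coordinates; off the edges
        every density has the same value.\<close>
      have "\<sigma> e = undefined" if "\<sigma> \<in> densities G" for \<sigma>
        using that False by (auto simp: densities_def)
      then have "\<rho>' e = \<rho> l e" if "0 < l" for l
        using optimal_mem[OF opt0] optimal_mem[OF opt[OF that]] adm_subset by (metis subsetD)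
      then have "\<forall>\<^sub>F l in at_right 0. \<rho>' e = \<rho> l e"
        by (auto simp: eventually_at_filter)
      then show ?thesis by (rule Lim_transform_eventually[OF tendsto_const])
    qed
  qed
qed

end

section \<open>Time-respecting paths as an instance\<close>

lemma temporal_family_trp:
  assumes "wf_temporal_graph G" "s \<noteq> t"
    and "continuous_on UNIV \<phi>" "mono \<phi>" "\<phi> 0 = 1"
  shows "temporal_family G \<phi> (trp G s t)"
proof
  fix \<gamma> assume "\<gamma> \<in> trp G s t"
  then obtain es ts where \<gamma>: "\<gamma> = set (zip es ts)" and len: "length es = length ts"
    and dist: "distinct es" and path: "is_path G s es t"
    and times: "\<forall>i<length es. ts ! i \<in> times G (es ! i)"
    by (auto simp: trp_def)
  show "finite \<gamma>" by (simp add: \<gamma>)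
  \<comment> \<open>Without edges the vertex list has a single entry, which is both its head and its
    last element, so \<open>s = t\<close>.\<close>
  have "es \<noteq> []"
    using path assms(2) by (auto simp: is_path_def length_Suc_conv)
  with len show "\<gamma> \<noteq> {}" by (cases es; cases ts) (auto simp: \<gamma>)
  \<comment> \<open>The first components of the zipped list are exactly \<open>es\<close>, which is
    distinct.\<close>
  show "inj_on fst \<gamma>"
    using dist len distinct_map[of fst "zip es ts"] by (simp add: \<gamma>)
  show "\<gamma> \<subseteq> Sigma (edges G) (times G)"
    using path times by (force simp: \<gamma> set_zip is_path_def)
qed (use assms in auto)

theorem theorem3p5:
  fixes G :: "('v, 'e) temporal_graph"
    and s t :: 'v
    and \<phi> :: "real \<Rightarrow> real"
    and p :: ereal
    and \<Gamma> :: "('e \<times> real) set set"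
    and C :: "'e set set"
  assumes "wf_temporal_graph G"
    and "s \<in> verts G" and "t \<in> verts G" and "s \<noteq> t"
    and "\<And>x. 0 \<le> \<phi> x" and "continuous_on UNIV \<phi>" and "strict_mono \<phi>" and "\<phi> 0 = 1"
    and "1 \<le> p"
    and "\<Gamma> = trp G s t" and "C = projection \<Gamma>"
  shows "antimono_on {0<..} (\<lambda>l. temporal_Mod G \<phi> p l \<Gamma>) \<and>
    ((\<lambda>l. temporal_Mod G \<phi> p l \<Gamma>) \<longlongrightarrow> static_Mod G p C) (at_right 0) \<and>
    (1 < p \<and> p < \<infinity> \<longrightarrow>
      (\<forall>l>0. \<exists>!\<rho>. temporal_optimal G \<phi> p l \<Gamma> \<rho>) \<and>
      (\<exists>!\<rho>. static_optimal G p C \<rho>) \<and>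
      (\<forall>\<rho> \<rho>'. (\<forall>l>0. temporal_optimal G \<phi> p l \<Gamma> (\<rho> l)) \<and> static_optimal G p C \<rho>' \<longrightarrow>
        (\<rho> \<longlongrightarrow> \<rho>') (at_right 0)))"
proof -
  interpret temporal_family G \<phi> \<Gamma>
    unfolding assms(10) using assms(1-8) by (intro temporal_family_trp strict_mono_mono)
  have "antimono_on {0<..} (\<lambda>l. temporal_Mod G \<phi> p l \<Gamma>)"
    using Mod_antimono assms(9) by (intro monotone_onI) auto
  \<comment> \<open>Including \<open>l = 0\<close> covers the unique static optimal density as
    well.\<close>
  moreover have "\<exists>!\<rho>. temporal_optimal G \<phi> p l \<Gamma> \<rho>" if "1 < p" "p < \<infinity>" "0 \<le> l" for l
    using optimal_ex1 that by blast
  ultimately show ?thesis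
    using Mod_tendsto[OF assms(9)] optimal_tendsto
    unfolding assms(11) static_Mod_eq static_optimal_eq by auto
qed

end
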